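(* There are an absolute constant $C>0$ and, for each $p\in[1,\infty)$, a constant $C_p>0$ depending only on $p$, such that the following holds. (i) For every $1\le p<\infty$, every real-valued $f\in L^p([0,1])$ and every positive integer $n$, there exist $q_0,\dots,q_n\in\mathbb{Z}$ such that $$\left\|f-\sum_{k=0}^n q_k\,p_{n,k}\right\|_p\le C\left(E_n(f)_p+C_p\,\theta_p(n)\right),\qquad \theta_p(n):=\begin{cases}n^{-1/2},&1\le p<2,\\ \sqrt{\frac{\log n}{n}},&p=2,\\ n^{-1/p},&2<p<\infty.\end{cases}$$ (ii) For every continuous $f:[0,1]\to\mathbb{R}$ and every positive integer $n$, there exist $q_0,\dots,q_n\in\mathbb{Z}$ such that for all $x\in[0,1]$, with $X:=x(1-x)$, $$\left|f(x)-\sum_{k=0}^n q_k\,p_{n,k}(x)\right|\le C\left(E_n(f)_\infty+\frac{1}{1+\sqrt{nX}}\right).$$ (iii) Consequently, for any sequence $(n_j)_{j=1}^\infty$ of positive integers with $n_j\to\infty$, the set $\bigcup_{j=1}^\infty\mathcal{L}(\mathscr{B}_{n_j})$ is dense in $L^p([0,1])$ for all $p\in[1,\infty)$, and (by restriction to $[a,b]$) in $C([a,b])$ for all $0<a<b<1$.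
   Context: All functions are real-valued. For $0\le k\le n$, $p_{n,k}(x):=\binom{n}{k}x^k(1-x)^{n-k}$; $\mathscr{B}_n:=(p_{n,k})_{k=0}^n$ is the Bernstein basis of the space $\mathcal{P}_n$ of real polynomials of degree at most $n$. The Bernstein lattice is $\mathcal{L}(\mathscr{B}_n):=\{\sum_{k=0}^n q_kp_{n,k}:q_0,\dots,q_n\in\mathbb{Z}\}$. For $1\le p<\infty$ and $f\in L^p([0,1])$, $E_n(f)_p:=\inf_{P\in\mathcal{P}_n}\|f-P\|_{L^p([0,1])}$; for $f\in C([0,1])$, $E_n(f)_\infty:=\inf_{P\in\mathcal{P}_n}\sup_{x\in[0,1]}|f(x)-P(x)|$. $\|\cdot\|_p$ is the $L^p([0,1])$ norm.
   Formalization: Part (i) excludes the single case p = 2, n = 1: there log 1 = 0 makes θ_2(1) = 0, and the claim fails for f = 1/2, since E_1(f)_2 = 0 but 1/2 is not q_0(1−x) + q_1 x with integers q_0, q_1. *)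

theory Defs
  imports "HOL-Analysis.Analysis" "HOL-Computational_Algebra.Polynomial"
begin

(* The Bernstein polynomials p_{n,k} are the library's Bernstein n k. *)

(* Elements of L^p([0,1]) are represented by functions on the whole line, not by
   equivalence classes; only their values almost everywhere on [0,1] matter. *)

definition Lp01 :: "real \<Rightarrow> (real \<Rightarrow> real) set" where
  "Lp01 p = {f. f \<in> borel_measurable (lebesgue_on {0..1}) \<and>
                integrable (lebesgue_on {0..1}) (\<lambda>x. \<bar>f x\<bar> powr p)}"

definition Lp_norm :: "real \<Rightarrow> (real \<Rightarrow> real) \<Rightarrow> real" where
  "Lp_norm p f = (integral\<^sup>L (lebesgue_on {0..1}) (\<lambda>x. \<bar>f x\<bar> powr p)) powr (1 / p)"

definition best_approx_Lp :: "nat \<Rightarrow> real \<Rightarrow> (real \<Rightarrow> real) \<Rightarrow> real" where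
  "best_approx_Lp n p f = (INF P\<in>{P :: real poly. degree P \<le> n}. Lp_norm p (\<lambda>x. f x - poly P x))"

definition best_approx_sup :: "nat \<Rightarrow> (real \<Rightarrow> real) \<Rightarrow> real" where
  "best_approx_sup n f = (INF P\<in>{P :: real poly. degree P \<le> n}. SUP x\<in>{0..1}. \<bar>f x - poly P x\<bar>)"

definition theta :: "real \<Rightarrow> nat \<Rightarrow> real" where
  "theta p n = (if p < 2 then real n powr (- 1 / 2)
                else if p = 2 then sqrt (ln (real n) / real n)
                else real n powr (- 1 / p))"

definition Bernstein_lattice :: "nat \<Rightarrow> (real \<Rightarrow> real) set" where
  "Bernstein_lattice n = range (\<lambda>q :: nat \<Rightarrow> int. \<lambda>x. \<Sum>k\<le>n. of_int (q k) * Bernstein n k x)"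

(* Density for the seminorm Lp_norm p on representatives, which is density in the quotient. *)
definition dense_in_Lp01 :: "real \<Rightarrow> (real \<Rightarrow> real) set \<Rightarrow> bool" where
  "dense_in_Lp01 p S \<longleftrightarrow>
     S \<subseteq> Lp01 p \<and> (\<forall>f\<in>Lp01 p. \<forall>\<epsilon>>0. \<exists>g\<in>S. Lp_norm p (\<lambda>x. f x - g x) < \<epsilon>)"

(* C([a,b]) with the maximum metric; its elements are extensional functions on [a,b]. *)
definition C_interval :: "real \<Rightarrow> real \<Rightarrow> (real \<Rightarrow> real) metric" where
  "C_interval a b = cfunspace (top_of_set {a..b}) euclidean_metric"

end

theory Submission
  imports Defs "HOL-Real_Asymp.Real_Asymp"
begin

text \<open>
  Round the Bernstein coefficients \<open>c\<^sub>k\<close> of a near-best polynomial to integers \<open>q\<^sub>k\<close> so that all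
  partial sums of \<open>c\<^sub>k - q\<^sub>k\<close> are at most 1/2 in absolute value. Summation by parts then bounds the
  rounding error at \<open>x\<close> by half the total variation of \<open>k \<mapsto> p\<^sub>n\<^sub>,\<^sub>k(x)\<close>. With \<open>N = n + 1\<close> and
  \<open>X = x(1 - x)\<close>,
  \<open>N X (p\<^sub>n\<^sub>,\<^sub>k(x) - p\<^sub>n\<^sub>,\<^sub>k\<^sub>+\<^sub>1(x)) = (k + 1 - N x) p\<^sub>N\<^sub>,\<^sub>k\<^sub>+\<^sub>1(x)\<close>,
  so this variation is at most the mean absolute deviation of the binomial distribution divided by
  \<open>N X\<close>, hence at most \<open>1/sqrt (N X)\<close>. Integrating the \<open>p\<close>-th power of the resulting bound
  \<open>2/(1 + sqrt (n X))\<close> produces \<open>\<theta>\<^sub>p(n)\<close>.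
\<close>

subsection \<open>Variation of the Bernstein basis in its index\<close>

lemma Bernstein_eq_0: "n < k \<Longrightarrow> Bernstein n k x = 0"
  by (simp add: Bernstein_def)

lemma Bernstein_Suc_Suc: "real (Suc k) * Bernstein (Suc n) (Suc k) x = real (Suc n) * x * Bernstein n k x"
proof -
  have "real (Suc k) * real (Suc n choose Suc k) = real (Suc n) * real (n choose k)"
    by (metis Suc_times_binomial_eq of_nat_mult mult.commute)
  then show ?thesis
    by (simp add: Bernstein_def del: of_nat_Suc binomial_Suc_Suc)
qed

lemma Bernstein_Suc_right:
  "(real (Suc n) - real k) * Bernstein (Suc n) k x = real (Suc n) * (1 - x) * Bernstein n k x"
proof (cases "k \<le> n")
  case True
  have "(Suc n - k) * (Suc n choose k) = Suc n * (n choose k)"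
    using binomial_absorb_comp[of "Suc n" k] by simp
  then have "(real (Suc n) - real k) * real (Suc n choose k) = real (Suc n) * real (n choose k)"
    using True by (metis of_nat_mult of_nat_diff le_SucI)
  then show ?thesis
    using True by (simp add: Bernstein_def Suc_diff_le del: of_nat_Suc binomial_Suc_Suc)
next
  case False
  then show ?thesis
    by (cases "k = Suc n") (auto simp: Bernstein_eq_0)
qed

text \<open>With \<open>N = Suc n\<close>, the factor \<open>k + 1 - N x\<close> splits as
  \<open>(1 - x) (k + 1) - x (N - (k + 1))\<close>. The two degree-raising identities above then
  turn each half into a multiple of a polynomial of degree \<open>n\<close>.\<close>

lemma Bernstein_consecutive_diff:
  "real (Suc n) * (x * (1 - x)) * (Bernstein n k x - Bernstein n (Suc k) x)
     = (real (Suc k) - real (Suc n) * x) * Bernstein (Suc n) (Suc k) x"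
proof -
  have "(real (Suc k) - real (Suc n) * x) * Bernstein (Suc n) (Suc k) x
      = (1 - x) * (real (Suc k) * Bernstein (Suc n) (Suc k) x)
        - x * ((real (Suc n) - real (Suc k)) * Bernstein (Suc n) (Suc k) x)"
    by (simp add: algebra_simps)
  also have "\<dots> = real (Suc n) * (x * (1 - x)) * (Bernstein n k x - Bernstein n (Suc k) x)"
    unfolding Bernstein_Suc_Suc Bernstein_Suc_right by (simp add: algebra_simps)
  finally show ?thesis ..
qed

text \<open>The square is expanded in \<open>k (k - 1)\<close>, \<open>k\<close> and
  \<open>1\<close>, whose Bernstein sums are the factorial moments of the binomial
  distribution.\<close>

lemma Bernstein_variance:
  "(\<Sum>k\<le>n. (real k - real n * x)\<^sup>2 * Bernstein n k x) = real n * (x * (1 - x))"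
proof -
  have "(\<Sum>k\<le>n. (real k - real n * x)\<^sup>2 * Bernstein n k x)
      = (\<Sum>k\<le>n. real k * (real k - 1) * Bernstein n k x)
        + (1 - 2 * real n * x) * (\<Sum>k\<le>n. real k * Bernstein n k x)
        + (real n * x)\<^sup>2 * (\<Sum>k\<le>n. Bernstein n k x)"
    unfolding sum_distrib_left sum.distrib[symmetric]
    by (intro sum.cong) (simp_all add: power2_eq_square algebra_simps)
  then show ?thesis
    unfolding sum_kk_Bernstein sum_k_Bernstein sum_Bernstein
    by (simp add: power2_eq_square algebra_simps)
qed

lemma Bernstein_mean_deviation:
  assumes "0 < n" "0 < x" "x < 1"
  shows "(\<Sum>k\<le>n. \<bar>real k - real n * x\<bar> * Bernstein n k x) \<le> sqrt (real n * (x * (1 - x)))"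
proof -
  define s where "s = sqrt (real n * (x * (1 - x)))"
  have s: "s > 0" "s\<^sup>2 = real n * (x * (1 - x))"
    using assms by (auto simp: s_def)
  \<comment> \<open>AM-GM with weight \<open>s\<close>, the standard deviation, takes the place of
    Cauchy-Schwarz: averaging the right-hand side gives exactly \<open>s\<close>.\<close>
  have "\<bar>real k - real n * x\<bar> \<le> ((real k - real n * x)\<^sup>2 / s + s) / 2" for k
  proof -
    have "0 \<le> (\<bar>real k - real n * x\<bar> - s)\<^sup>2" by simp
    then show ?thesis using s by (simp add: field_simps power2_eq_square)
  qed
  then have "(\<Sum>k\<le>n. \<bar>real k - real n * x\<bar> * Bernstein n k x)
      \<le> (\<Sum>k\<le>n. ((real k - real n * x)\<^sup>2 / s + s) / 2 * Bernstein n k x)"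
    using assms by (intro sum_mono mult_right_mono Bernstein_nonneg) auto
  also have "\<dots> = (\<Sum>k\<le>n. (real k - real n * x)\<^sup>2 * Bernstein n k x) / s / 2
      + s / 2 * (\<Sum>k\<le>n. Bernstein n k x)"
    by (simp only: sum.distrib sum_divide_distrib sum_distrib_left add_divide_distrib distrib_right)
       (simp add: mult.commute)
  also have "\<dots> = s"
    unfolding Bernstein_variance sum_Bernstein using s by (simp add: power2_eq_square flip: s(2))
  finally show ?thesis by (simp add: s_def)
qed

lemma Bernstein_variation:
  assumes "0 \<le> x" "x \<le> 1"
  shows "(\<Sum>k\<le>n. \<bar>Bernstein n k x - Bernstein n (Suc k) x\<bar>)
          \<le> 4 / (1 + sqrt (real n * (x * (1 - x))))"
proof -
  define V where "V = (\<Sum>k\<le>n. \<bar>Bernstein n k x - Bernstein n (Suc k) x\<bar>)"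
  define s where "s = sqrt (real n * (x * (1 - x)))"
  have s0: "s \<ge> 0" using assms by (simp add: s_def)
  \<comment> \<open>The trivial bound, which takes care of \<open>x\<close> near the endpoints,
    where \<open>s\<close> is small.\<close>
  have "V \<le> (\<Sum>k\<le>n. Bernstein n k x + Bernstein n (Suc k) x)"
    unfolding V_def using Bernstein_nonneg[OF assms]
    by (intro sum_mono) (smt (verit, ccfv_threshold))
  also have "\<dots> = 1 + (\<Sum>k\<le>n. Bernstein n (Suc k) x)"
    by (simp add: sum.distrib)
  also have "(\<Sum>k\<le>n. Bernstein n (Suc k) x) \<le> (\<Sum>k\<le>Suc n. Bernstein n k x)"
    unfolding sum.atMost_Suc_shift using Bernstein_nonneg[OF assms] by simp
  also have "\<dots> = 1" by (simp add: Bernstein_eq_0)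
  finally have V2: "V \<le> 2" by simp
  have "V * s \<le> 2"
  proof (cases "s = 0")
    case False
    then have "x \<noteq> 0" "x \<noteq> 1" by (auto simp: s_def)
    with assms have x: "0 < x" "x < 1" by auto
    define D where "D = real (Suc n) * (x * (1 - x))"
    have D: "D > 0" using x by (simp add: D_def del: of_nat_Suc)
    have "D * V = (\<Sum>k\<le>n. \<bar>D * (Bernstein n k x - Bernstein n (Suc k) x)\<bar>)"
      unfolding V_def sum_distrib_left abs_mult using D by simp
    also have "\<dots> = (\<Sum>k\<le>n. \<bar>real (Suc k) - real (Suc n) * x\<bar> * Bernstein (Suc n) (Suc k) x)"
      unfolding D_def Bernstein_consecutive_diff abs_mult
      using Bernstein_nonneg[OF assms] by simp
    \<comment> \<open>The shifted sum lacks only the nonnegative term with index 0; adding it gives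
      the full mean deviation for degree \<open>Suc n\<close>.\<close>
    also have "\<dots> \<le> (\<Sum>k\<le>Suc n. \<bar>real k - real (Suc n) * x\<bar> * Bernstein (Suc n) k x)"
      unfolding sum.atMost_Suc_shift using Bernstein_nonneg[OF assms] by simp
    also have "\<dots> \<le> sqrt D"
      unfolding D_def using x by (intro Bernstein_mean_deviation) auto
    finally have "D * V \<le> sqrt D" .
    moreover have "D * V = sqrt D * (sqrt D * V)" using D by (simp flip: mult.assoc)
    ultimately have "sqrt D * V \<le> 1"
      using D by (metis mult_le_cancel_left_pos mult.right_neutral real_sqrt_gt_zero)
    moreover have "s \<le> sqrt D" "V \<ge> 0"
      using assms by (auto simp: s_def D_def V_def mult_right_mono intro!: sum_nonneg)
    ultimately show ?thesis
      using mult_right_mono[of s "sqrt D" V] by (simp add: mult.commute)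
  qed simp
  \<comment> \<open>Adding \<open>V \<le> 2\<close> and \<open>V * s \<le> 2\<close> merges both
    regimes into one bound.\<close>
  with V2 have "V * (1 + s) \<le> 4" by (simp add: algebra_simps)
  then show ?thesis
    using s0 unfolding V_def[symmetric] s_def[symmetric] by (simp add: field_simps)
qed


subsection \<open>Integer rounding of Bernstein coefficients\<close>

text \<open>Abel summation. The boundary term sits at \<open>Suc n\<close>, where a Bernstein
  polynomial of degree \<open>n\<close> vanishes.\<close>

lemma sum_by_parts_atMost:
  fixes r b :: "nat \<Rightarrow> real"
  shows "(\<Sum>k\<le>n. r k * b k)
    = (\<Sum>k\<le>n. (\<Sum>j\<le>k. r j) * (b k - b (Suc k))) + (\<Sum>j\<le>n. r j) * b (Suc n)"
  by (induction n) (simp_all add: algebra_simps)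

text \<open>The partial sums are rounded rather than the \<open>c j\<close>, and \<open>q\<close>
  consists of the differences of the rounded values, so rounding errors cannot accumulate.\<close>

lemma exists_int_bounded_partial_sums:
  fixes c :: "nat \<Rightarrow> real"
  shows "\<exists>q :: nat \<Rightarrow> int. \<forall>k. \<bar>\<Sum>j\<le>k. c j - of_int (q j)\<bar> \<le> 1 / 2"
proof -
  define Q where "Q k = round (\<Sum>j\<le>k. c j)" for k
  define q where "q k = (case k of 0 \<Rightarrow> Q 0 | Suc i \<Rightarrow> Q k - Q i)" for k
  have "(\<Sum>j\<le>k. q j) = Q k" for k
    by (induction k) (simp_all add: q_def)
  then have "(\<Sum>j\<le>k. real_of_int (q j)) = of_int (Q k)" for k
    by (metis of_int_sum)
  then have "\<bar>\<Sum>j\<le>k. c j - of_int (q j)\<bar> \<le> 1 / 2" for k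
    using of_int_round_abs_le[of "\<Sum>j\<le>k. c j"]
    by (simp add: sum_subtractf Q_def abs_minus_commute)
  then show ?thesis by blast
qed

text \<open>The rounding depends on the sequence \<open>c\<close> alone, so one \<open>q\<close>
  serves every degree. The constant 2 is the bound 1/2 on the partial sums times the 4 of
  \<open>Bernstein_variation\<close>.\<close>

lemma integer_Bernstein_rounding:
  fixes c :: "nat \<Rightarrow> real"
  shows "\<exists>q :: nat \<Rightarrow> int. \<forall>n. \<forall>x\<in>{0..1}.
    \<bar>(\<Sum>k\<le>n. c k * Bernstein n k x) - (\<Sum>k\<le>n. of_int (q k) * Bernstein n k x)\<bar>
      \<le> 2 / (1 + sqrt (real n * (x * (1 - x))))"
proof -
  obtain q :: "nat \<Rightarrow> int" where q: "\<And>k. \<bar>\<Sum>j\<le>k. c j - of_int (q j)\<bar> \<le> 1 / 2"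
    using exists_int_bounded_partial_sums by blast
  have "\<bar>(\<Sum>k\<le>n. c k * Bernstein n k x) - (\<Sum>k\<le>n. of_int (q k) * Bernstein n k x)\<bar>
      \<le> 2 / (1 + sqrt (real n * (x * (1 - x))))" if x: "x \<in> {0..1}" for n x
  proof -
    have "(\<Sum>k\<le>n. c k * Bernstein n k x) - (\<Sum>k\<le>n. of_int (q k) * Bernstein n k x)
        = (\<Sum>k\<le>n. (c k - of_int (q k)) * Bernstein n k x)"
      by (simp add: sum_subtractf left_diff_distrib)
    also have "\<dots> = (\<Sum>k\<le>n. (\<Sum>j\<le>k. c j - of_int (q j)) * (Bernstein n k x - Bernstein n (Suc k) x))"
      by (subst sum_by_parts_atMost) (simp add: Bernstein_eq_0)
    also have "\<bar>\<dots>\<bar> \<le> (\<Sum>k\<le>n. 1 / 2 * \<bar>Bernstein n k x - Bernstein n (Suc k) x\<bar>)"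
      by (intro order.trans[OF sum_abs] sum_mono)
         (simp only: abs_mult, intro mult_right_mono q, simp)
    also have "\<dots> \<le> 2 / (1 + sqrt (real n * (x * (1 - x))))"
      using Bernstein_variation[of x n] x unfolding sum_distrib_left[symmetric] by simp
    finally show ?thesis .
  qed
  then show ?thesis by blast
qed

lemma poly_eq_Bernstein_sum:
  fixes P :: "real poly"
  assumes "degree P \<le> n"
  shows "\<exists>c. \<forall>x. poly P x = (\<Sum>k\<le>n. c k * Bernstein n k x)"
  using assms
proof (induction n arbitrary: P)
  case 0
  then obtain a where "P = [:a:]" by (metis degree_eq_zeroE le_zero_eq)
  then show ?case by (auto simp: Bernstein_def intro!: exI[of _ "\<lambda>_. a"])
next
  case (Suc n)
  obtain a Q where P: "P = pCons a Q" by (cases P)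
  with Suc.prems have "degree Q \<le> n" by (cases "Q = 0") auto
  then obtain c where c: "\<And>x. poly Q x = (\<Sum>k\<le>n. c k * Bernstein n k x)"
    using Suc.IH by blast
  \<comment> \<open>Multiplication by \<open>x\<close> raises the degree and shifts the index:
    \<open>x\<close> times \<open>Bernstein n k x\<close> is \<open>(k + 1) / (n + 1)\<close> times
    \<open>Bernstein (Suc n) (Suc k) x\<close>. The constant \<open>a\<close> is spread over all
    coefficients by the partition of unity.\<close>
  define d where "d k = (case k of 0 \<Rightarrow> 0 | Suc i \<Rightarrow> c i * real k / real (Suc n))" for k
  have *: "c k * (x * Bernstein n k x) = d (Suc k) * Bernstein (Suc n) (Suc k) x" for k x
    using Bernstein_Suc_Suc[of k n x] by (simp add: d_def field_simps del: of_nat_Suc)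
  have "poly P x = (\<Sum>k\<le>Suc n. (a + d k) * Bernstein (Suc n) k x)" for x
  proof -
    have "poly P x = a + (\<Sum>k\<le>n. c k * (x * Bernstein n k x))"
      by (simp add: P c sum_distrib_left algebra_simps)
    also have "(\<Sum>k\<le>n. c k * (x * Bernstein n k x)) = (\<Sum>k\<le>Suc n. d k * Bernstein (Suc n) k x)"
      unfolding * sum.atMost_Suc_shift by (simp add: d_def)
    also have "a + \<dots> = (\<Sum>k\<le>Suc n. (a + d k) * Bernstein (Suc n) k x)"
      by (simp only: distrib_right sum.distrib sum_Bernstein mult_1_right flip: sum_distrib_left)
    finally show ?thesis .
  qed
  then show ?case by (intro exI[of _ "\<lambda>k. a + d k"]) blast
qed

subsection \<open>The \<open>L\<^sup>p\<close> norm on the unit interval\<close>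

text \<open>Write \<open>t powr p\<close> as \<open>t * t powr (p - 1)\<close> and use that the
  second factor is nondecreasing in \<open>t\<close>.\<close>

lemma powr_add_le:
  fixes a b p :: real
  assumes "0 \<le> a" "0 \<le> b" "1 \<le> p"
  shows "a powr p + b powr p \<le> (a + b) powr p"
proof (cases "a = 0 \<or> b = 0")
  case True
  then show ?thesis using assms by auto
next
  case False
  then have pos: "0 < a" "0 < b" using assms by auto
  have split: "t powr p = t * t powr (p - 1)" if "0 < t" for t :: real
    using that by (simp add: powr_mult_base)
  have "a * a powr (p - 1) + b * b powr (p - 1) \<le> a * (a + b) powr (p - 1) + b * (a + b) powr (p - 1)"
    using pos assms by (intro add_mono mult_left_mono powr_mono2) auto
  then show ?thesis
    using pos by (simp add: split[of a] split[of b] split[of "a + b"] distrib_right)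
qed

lemma abs_add_powr_le:
  fixes a b p :: real
  assumes "0 \<le> p"
  shows "\<bar>a + b\<bar> powr p \<le> 2 powr p * (\<bar>a\<bar> powr p + \<bar>b\<bar> powr p)"
proof -
  have "\<bar>a + b\<bar> powr p \<le> (2 * max \<bar>a\<bar> \<bar>b\<bar>) powr p"
    using assms by (intro powr_mono2) auto
  also have "\<dots> = 2 powr p * (max \<bar>a\<bar> \<bar>b\<bar>) powr p"
    by (rule powr_mult)
  also have "\<dots> \<le> 2 powr p * (\<bar>a\<bar> powr p + \<bar>b\<bar> powr p)"
    by (intro mult_left_mono) (auto simp: max_def)
  finally show ?thesis .
qed

lemma Lp_norm_nonneg: "0 \<le> Lp_norm p f"
  by (simp add: Lp_norm_def)

lemma Lp_norm_powr:
  assumes "1 \<le> p"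
  shows "Lp_norm p f powr p = (\<integral>x. \<bar>f x\<bar> powr p \<partial>lebesgue_on {0..1})"
  using assms by (simp add: Lp_norm_def powr_powr)

lemma Lp01_add:
  assumes "1 \<le> p" "f \<in> Lp01 p" "g \<in> Lp01 p"
  shows "(\<lambda>x. f x + g x) \<in> Lp01 p"
proof -
  note meas [measurable] =
    assms(2)[unfolded Lp01_def, simplified, THEN conjunct1]
    assms(3)[unfolded Lp01_def, simplified, THEN conjunct1]
  have "integrable (lebesgue_on {0..1}) (\<lambda>x. 2 powr p * (\<bar>f x\<bar> powr p + \<bar>g x\<bar> powr p))"
    using assms by (auto simp: Lp01_def)
  then have "integrable (lebesgue_on {0..1}) (\<lambda>x. \<bar>f x + g x\<bar> powr p)"
    by (rule Bochner_Integration.integrable_bound) (use assms abs_add_powr_le in auto)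
  then show ?thesis by (simp add: Lp01_def)
qed

lemma Lp01_minus: "f \<in> Lp01 p \<Longrightarrow> (\<lambda>x. - f x) \<in> Lp01 p"
  by (auto simp: Lp01_def)

lemma Lp01_diff:
  assumes "1 \<le> p" "f \<in> Lp01 p" "g \<in> Lp01 p"
  shows "(\<lambda>x. f x - g x) \<in> Lp01 p"
  using Lp01_add[OF assms(1,2) Lp01_minus[OF assms(3)]] by simp

text \<open>The factor 2 is harmless here, since only an absolute constant matters in the end.\<close>

lemma Lp_norm_add_le:
  assumes p: "1 \<le> p" and f: "f \<in> Lp01 p" and g: "g \<in> Lp01 p"
  shows "Lp_norm p (\<lambda>x. f x + g x) \<le> 2 * (Lp_norm p f + Lp_norm p g)"
proof -
  have int: "integrable (lebesgue_on {0..1}) (\<lambda>x. \<bar>f x\<bar> powr p)"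
    "integrable (lebesgue_on {0..1}) (\<lambda>x. \<bar>g x\<bar> powr p)"
    "integrable (lebesgue_on {0..1}) (\<lambda>x. \<bar>f x + g x\<bar> powr p)"
    using assms Lp01_add[OF assms] by (auto simp: Lp01_def)
  have "Lp_norm p (\<lambda>x. f x + g x) powr p
      \<le> (\<integral>x. 2 powr p * (\<bar>f x\<bar> powr p + \<bar>g x\<bar> powr p) \<partial>lebesgue_on {0..1})"
    unfolding Lp_norm_powr[OF p]
    using int p by (intro integral_mono abs_add_powr_le) auto
  also have "\<dots> = 2 powr p * (Lp_norm p f powr p + Lp_norm p g powr p)"
    unfolding Lp_norm_powr[OF p] using int by simp
  also have "\<dots> \<le> 2 powr p * (Lp_norm p f + Lp_norm p g) powr p"
    using p by (intro mult_left_mono powr_add_le Lp_norm_nonneg) auto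
  also have "\<dots> = (2 * (Lp_norm p f + Lp_norm p g)) powr p"
    by (rule powr_mult[symmetric])
  finally have le: "Lp_norm p (\<lambda>x. f x + g x) powr p \<le> (2 * (Lp_norm p f + Lp_norm p g)) powr p" .
  show ?thesis
  proof (rule ccontr)
    assume "\<not> ?thesis"
    then have "(2 * (Lp_norm p f + Lp_norm p g)) powr p < Lp_norm p (\<lambda>x. f x + g x) powr p"
      using p by (intro powr_less_mono2) (simp_all add: Lp_norm_nonneg)
    with le show False by simp
  qed
qed

lemma Lp01_continuous:
  assumes "1 \<le> p" "continuous_on {0..1} f"
  shows "f \<in> Lp01 p"
proof -
  have "continuous_on {0..1} (\<lambda>x. \<bar>f x\<bar> powr p)"
    by (rule continuous_on_powr'[OF continuous_on_rabs[OF assms(2)] continuous_on_const])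
       (use assms(1) in auto)
  then show ?thesis
    using assms by (auto simp: Lp01_def intro!: continuous_imp_integrable_real
      continuous_imp_measurable_on_sets_lebesgue)
qed

text \<open>Links the gauge integral, in which the fundamental theorem of calculus is stated, to the
  Lebesgue integral inside \<open>Lp_norm\<close>; continuity makes \<open>h\<close> Lebesgue
  integrable.\<close>

lemma Lp_norm_le_powr:
  assumes p: "1 \<le> p" and f: "f \<in> Lp01 p" and h: "(h has_integral J) {0..1}" "continuous_on {0..1} h"
    and le: "\<And>x. x \<in> {0..1} \<Longrightarrow> \<bar>f x\<bar> powr p \<le> h x"
  shows "Lp_norm p f \<le> J powr (1 / p)"
proof -
  have h': "integrable (lebesgue_on {0..1}) h"
    by (rule continuous_imp_integrable_real) (rule h)
  have "(\<integral>x. \<bar>f x\<bar> powr p \<partial>lebesgue_on {0..1}) \<le> (\<integral>x. h x \<partial>lebesgue_on {0..1})"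
    using f h' le by (intro integral_mono) (auto simp: Lp01_def)
  also have "\<dots> = J"
    using h(1) h' by (simp add: lebesgue_integral_eq_integral integral_unique)
  finally show ?thesis
    using p unfolding Lp_norm_def by (intro powr_mono2) auto
qed

lemma Lp_norm_le_const:
  assumes p: "1 \<le> p" and f: "f \<in> Lp01 p" and le: "\<And>x. x \<in> {0..1} \<Longrightarrow> \<bar>f x\<bar> \<le> B"
  shows "Lp_norm p f \<le> B"
proof -
  have "0 \<le> B" using le[of 0] by auto
  have "((\<lambda>x. B powr p) has_integral B powr p) {0..1::real}"
    using has_integral_const_real[of "B powr p" 0 1] by simp
  then have "Lp_norm p f \<le> (B powr p) powr (1 / p)"
    using p le by (intro Lp_norm_le_powr[OF p f]) (auto intro!: powr_mono2)
  then show ?thesis using p \<open>0 \<le> B\<close> by (simp add: powr_powr)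
qed

lemma continuous_on_Bernstein_sum [continuous_intros]:
  "continuous_on S (\<lambda>x. \<Sum>k\<le>n. c k * Bernstein n k x)"
  unfolding Bernstein_def by (intro continuous_intros)

subsection \<open>Integration of the rounding error\<close>

text \<open>The two summands describe decay away from the endpoints 0 and 1. They are mirror images,
  hence the factor 2. The power antiderivative breaks down at \<open>a = 1\<close>, which is treated
  separately below.\<close>

lemma has_integral_decay:
  fixes a m :: real
  assumes m: "0 < m" and a: "a \<noteq> 1"
  shows "((\<lambda>x. (1 + m * x) powr - a + (1 + m * (1 - x)) powr - a)
    has_integral 2 * ((1 + m) powr (1 - a) - 1) / (m * (1 - a))) {0..1}"
proof -
  define F where "F x = ((1 + m * x) powr (1 - a) - (1 + m * (1 - x)) powr (1 - a)) / (m * (1 - a))" for x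
  have "(F has_vector_derivative (1 + m * x) powr - a + (1 + m * (1 - x)) powr - a) (at x within {0..1})"
    if "x \<in> {0..1}" for x
  proof -
    have pos: "0 < 1 + m * x" "0 < 1 + m * (1 - x)"
      using that m by (auto intro!: add_pos_nonneg)
    have "((\<lambda>x. (1 + m * x) powr (1 - a)) has_real_derivative
        (1 - a) * (1 + m * x) powr (1 - a - of_nat 1) * m) (at x)"
      by (intro DERIV_fun_powr pos) (auto intro!: derivative_eq_intros)
    moreover have "((\<lambda>x. (1 + m * (1 - x)) powr (1 - a)) has_real_derivative
        (1 - a) * (1 + m * (1 - x)) powr (1 - a - of_nat 1) * (- m)) (at x)"
      by (intro DERIV_fun_powr pos) (auto intro!: derivative_eq_intros)
    ultimately have "(F has_real_derivative
        ((1 - a) * (1 + m * x) powr (1 - a - of_nat 1) * m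
          - (1 - a) * (1 + m * (1 - x)) powr (1 - a - of_nat 1) * (- m)) / (m * (1 - a))) (at x)"
      unfolding F_def by (intro DERIV_cdivide DERIV_diff)
    also have "((1 - a) * (1 + m * x) powr (1 - a - of_nat 1) * m
          - (1 - a) * (1 + m * (1 - x)) powr (1 - a - of_nat 1) * (- m)) / (m * (1 - a))
        = (m * (1 - a)) * ((1 + m * x) powr - a + (1 + m * (1 - x)) powr - a) / (m * (1 - a))"
      by (simp add: distrib_left mult_ac)
    also have "\<dots> = (1 + m * x) powr - a + (1 + m * (1 - x)) powr - a"
      using m a by simp
    finally show ?thesis
      by (simp add: has_real_derivative_iff_has_vector_derivative has_vector_derivative_at_within)
  qed
  then have "((\<lambda>x. (1 + m * x) powr - a + (1 + m * (1 - x)) powr - a) has_integral F 1 - F 0) {0..1}"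
    by (intro fundamental_theorem_of_calculus) auto
  also have "F 1 - F 0 = 2 * ((1 + m) powr (1 - a) - 1) / (m * (1 - a))"
    by (simp add: F_def flip: diff_divide_distrib)
  finally show ?thesis .
qed

lemma has_integral_decay_log:
  fixes m :: real
  assumes m: "0 < m"
  shows "((\<lambda>x. (1 + m * x) powr - 1 + (1 + m * (1 - x)) powr - 1) has_integral 2 * ln (1 + m) / m) {0..1}"
proof -
  define F where "F x = (ln (1 + m * x) - ln (1 + m * (1 - x))) / m" for x
  have "(F has_vector_derivative (1 + m * x) powr - 1 + (1 + m * (1 - x)) powr - 1) (at x within {0..1})"
    if "x \<in> {0..1}" for x
  proof -
    have pos: "0 < 1 + m * x" "0 < 1 + m * (1 - x)"
      using that m by (auto intro!: add_pos_nonneg)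
    have "((\<lambda>x. ln (1 + m * x)) has_real_derivative 1 / (1 + m * x) * m) (at x)"
      by (rule DERIV_chain2[OF DERIV_ln_divide]) (auto intro!: derivative_eq_intros pos)
    moreover have "((\<lambda>x. ln (1 + m * (1 - x))) has_real_derivative 1 / (1 + m * (1 - x)) * (- m)) (at x)"
      by (rule DERIV_chain2[OF DERIV_ln_divide]) (auto intro!: derivative_eq_intros pos)
    ultimately have "(F has_real_derivative
        (1 / (1 + m * x) * m - 1 / (1 + m * (1 - x)) * (- m)) / m) (at x)"
      unfolding F_def by (intro DERIV_cdivide DERIV_diff)
    also have "(1 / (1 + m * x) * m - 1 / (1 + m * (1 - x)) * (- m)) / m
        = m * ((1 + m * x) powr - 1 + (1 + m * (1 - x)) powr - 1) / m"
      using pos by (simp add: powr_minus inverse_eq_divide distrib_left)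
    also have "\<dots> = (1 + m * x) powr - 1 + (1 + m * (1 - x)) powr - 1"
      using m by simp
    finally show ?thesis
      by (simp add: has_real_derivative_iff_has_vector_derivative has_vector_derivative_at_within)
  qed
  then have "((\<lambda>x. (1 + m * x) powr - 1 + (1 + m * (1 - x)) powr - 1) has_integral F 1 - F 0) {0..1}"
    by (intro fundamental_theorem_of_calculus) auto
  also have "F 1 - F 0 = 2 * ln (1 + m) / m"
    by (simp add: F_def flip: diff_divide_distrib)
  finally show ?thesis .
qed

text \<open>\<open>X\<close> is at least half the distance to the nearer endpoint, and
  \<open>(1 + s)\<^sup>2 \<ge> 1 + s\<^sup>2\<close> removes the square root, halving the exponent.
  Adding the terms of both endpoints avoids splitting the integral at 1/2.\<close>

lemma decay_powr_le:
  fixes p x :: real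
  assumes p: "0 \<le> p" and x: "x \<in> {0..1}"
  shows "(2 / (1 + sqrt (real n * (x * (1 - x))))) powr p
    \<le> 2 powr p * ((1 + real n / 2 * x) powr - (p / 2) + (1 + real n / 2 * (1 - x)) powr - (p / 2))"
proof -
  define X where "X = x * (1 - x)"
  define s where "s = sqrt (real n * X)"
  have X: "0 \<le> X" using x by (simp add: X_def)
  then have s: "0 \<le> s" "s\<^sup>2 = real n * X" by (auto simp: s_def)
  have "x / 2 \<le> X \<or> (1 - x) / 2 \<le> X"
  proof (cases "x \<le> 1 / 2")
    case True
    then have "x * (1 / 2) \<le> x * (1 - x)" using x by (intro mult_left_mono) auto
    then show ?thesis by (simp add: X_def)
  next
    case False
    then have "1 / 2 * (1 - x) \<le> x * (1 - x)" using x by (intro mult_right_mono) auto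
    then show ?thesis by (simp add: X_def)
  qed
  then obtain y where y: "y = x \<or> y = 1 - x" "y / 2 \<le> X" by blast
  have y0: "0 \<le> y" using y x by auto
  have "1 + real n / 2 * y \<le> 1 + s\<^sup>2"
    unfolding s using mult_left_mono[OF y(2), of "real n"] by simp
  also have "\<dots> \<le> (1 + s)\<^sup>2" using s by (simp add: power2_eq_square algebra_simps)
  finally have le: "1 + real n / 2 * y \<le> (1 + s)\<^sup>2" .
  have "(2 / (1 + s)) powr p = 2 powr p * (1 + s) powr - p"
    using s by (simp add: powr_divide powr_minus_divide)
  also have "(1 + s) powr - p = ((1 + s)\<^sup>2) powr - (p / 2)"
    using s by (simp flip: powr_numeral add: powr_powr)
  also have "\<dots> \<le> (1 + real n / 2 * y) powr - (p / 2)"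
    using le y0 p by (intro powr_mono2') (auto intro: add_pos_nonneg)
  also have "\<dots> \<le> (1 + real n / 2 * x) powr - (p / 2) + (1 + real n / 2 * (1 - x)) powr - (p / 2)"
    using y by auto
  finally show ?thesis by (simp add: s_def X_def)
qed

text \<open>For \<open>a = p/2\<close>, this is, up to the factor \<open>2\<^sup>p\<close>, the integral bound for the \<open>p\<close>-th power of the
  rounding error.\<close>

definition decay_integral :: "real \<Rightarrow> nat \<Rightarrow> real" where
  "decay_integral a n = (if a = 1 then 4 * ln (1 + real n / 2) / real n
     else 4 * ((1 + real n / 2) powr (1 - a) - 1) / (real n * (1 - a)))"

lemma has_integral_decay_integral:
  assumes "0 < n"
  shows "((\<lambda>x. (1 + real n / 2 * x) powr - a + (1 + real n / 2 * (1 - x)) powr - a)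
    has_integral decay_integral a n) {0..1}"
  using has_integral_decay[of "real n / 2" a] has_integral_decay_log[of "real n / 2"] assms
  by (auto simp: decay_integral_def mult.commute)

text \<open>The exponent \<open>1 - p / 2\<close> decides: if positive, the numerator grows like
  that power of \<open>n\<close>; at zero it is a logarithm; if negative, the difference of powers
  stays bounded. For \<open>p = 2\<close> and \<open>n = 1\<close> the right-hand side is 0 but the
  integral is positive.\<close>

lemma decay_integral_le:
  assumes p: "1 \<le> p"
  shows "\<exists>K>0. \<forall>n. 0 < n \<and> \<not> (p = 2 \<and> n = 1) \<longrightarrow> decay_integral (p / 2) n \<le> K * theta p n powr p"
proof -
  consider "p < 2" | "p = 2" | "p > 2" by linarith
  then show ?thesis
  proof cases
    case 1
    define K where "K = 8 / (1 - p / 2)"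
    have "decay_integral (p / 2) n \<le> K * theta p n powr p" if n: "0 < n" for n
    proof -
      have "(1 + real n / 2) powr (1 - p / 2) \<le> (2 * real n) powr (1 - p / 2)"
        using 1 n by (intro powr_mono2) auto
      also have "\<dots> = 2 powr (1 - p / 2) * real n powr (1 - p / 2)"
        by (rule powr_mult)
      also have "\<dots> \<le> 2 * real n powr (1 - p / 2)"
        using p powr_mono[of "1 - p / 2" 1 2] by (intro mult_right_mono) auto
      also have "\<dots> = 2 * real n * real n powr - (p / 2)"
        using n by (simp add: powr_mult_base)
      finally have *: "(1 + real n / 2) powr (1 - p / 2) - 1 \<le> 2 * real n * real n powr - (p / 2)"
        by simp
      have "decay_integral (p / 2) n = 4 / (real n * (1 - p / 2)) * ((1 + real n / 2) powr (1 - p / 2) - 1)"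
        using 1 by (simp add: decay_integral_def)
      also have "\<dots> \<le> 4 / (real n * (1 - p / 2)) * (2 * real n * real n powr - (p / 2))"
        using 1 n by (intro mult_left_mono *) auto
      also have "\<dots> = K * theta p n powr p"
        using 1 n by (simp add: K_def theta_def powr_powr)
      finally show ?thesis .
    qed
    then show ?thesis using 1 by (intro exI[of _ K]) (auto simp: K_def)
  next
    case 2
    have "decay_integral (p / 2) n \<le> 4 * theta p n powr p" if n: "n > 1" for n
    proof -
      \<comment> \<open>Here \<open>n \<ge> 2\<close> enters, through
        \<open>1 + n / 2 \<le> n\<close>.\<close>
      have "ln (1 + real n / 2) \<le> ln (real n)" using n by (subst ln_le_cancel_iff) auto
      moreover have "theta p n powr p = ln (real n) / real n"
        using 2 n by (simp add: theta_def)
      ultimately show ?thesis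
        using 2 n by (simp add: decay_integral_def divide_right_mono)
    qed
    moreover have "n > 1" if "0 < n \<and> \<not> (p = 2 \<and> n = 1)" for n :: nat
      using that 2 by linarith
    ultimately show ?thesis by (intro exI[of _ 4]) auto
  next
    case 3
    define K where "K = 4 / (p / 2 - 1)"
    have "decay_integral (p / 2) n \<le> K * theta p n powr p" if n: "0 < n" for n
    proof -
      have "decay_integral (p / 2) n = 4 / (real n * (p / 2 - 1)) * (1 - (1 + real n / 2) powr (1 - p / 2))"
        using 3 n by (simp add: decay_integral_def field_simps)
      also have "\<dots> \<le> 4 / (real n * (p / 2 - 1)) * 1"
        using 3 n by (intro mult_left_mono) auto
      also have "theta p n powr p = real n powr - 1"
        using 3 by (simp add: theta_def powr_powr)
      then have "theta p n powr p = 1 / real n"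
        using n by (simp add: powr_minus_divide)
      then have "4 / (real n * (p / 2 - 1)) * 1 = K * theta p n powr p"
        by (simp add: K_def)
      finally show ?thesis .
    qed
    then show ?thesis using 3 by (intro exI[of _ K]) (auto simp: K_def)
  qed
qed

lemma theta_nonneg: "0 < n \<Longrightarrow> 0 \<le> theta p n"
  by (auto simp: theta_def)

lemma theta_pos: "0 < n \<Longrightarrow> \<not> (p = 2 \<and> n = 1) \<Longrightarrow> 0 < theta p n"
  by (auto simp: theta_def)

lemma theta_tendsto_0:
  assumes "1 \<le> p"
  shows "theta p \<longlonglongrightarrow> 0"
proof -
  consider "p < 2" | "p = 2" | "p > 2" by linarith
  then show ?thesis
  proof cases
    case 1
    have "(\<lambda>n. real n powr (- 1 / 2)) \<longlonglongrightarrow> 0" by real_asymp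
    then show ?thesis using 1 by (simp add: theta_def[abs_def])
  next
    case 2
    have "(\<lambda>n. sqrt (ln (real n) / real n)) \<longlonglongrightarrow> 0" by real_asymp
    then show ?thesis using 2 by (simp add: theta_def[abs_def])
  next
    case 3
    then have "(\<lambda>n. real n powr (- 1 / p)) \<longlonglongrightarrow> 0" by real_asymp
    then show ?thesis using 3 by (simp add: theta_def[abs_def])
  qed
qed

lemma integer_Bernstein_rounding_Lp:
  assumes p: "1 \<le> p"
  shows "\<exists>K>0. \<forall>n c. 0 < n \<and> \<not> (p = 2 \<and> n = 1) \<longrightarrow> (\<exists>q :: nat \<Rightarrow> int.
    Lp_norm p (\<lambda>x. (\<Sum>k\<le>n. c k * Bernstein n k x) - (\<Sum>k\<le>n. of_int (q k) * Bernstein n k x))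
      \<le> K * theta p n)"
proof -
  obtain K where K: "K > 0" "\<And>n. 0 < n \<and> \<not> (p = 2 \<and> n = 1) \<Longrightarrow> decay_integral (p / 2) n \<le> K * theta p n powr p"
    using decay_integral_le[OF p] by blast
  have "\<exists>q :: nat \<Rightarrow> int.
    Lp_norm p (\<lambda>x. (\<Sum>k\<le>n. c k * Bernstein n k x) - (\<Sum>k\<le>n. of_int (q k) * Bernstein n k x))
      \<le> 2 * K powr (1 / p) * theta p n" if n: "0 < n" "\<not> (p = 2 \<and> n = 1)" for n c
  proof -
    obtain q :: "nat \<Rightarrow> int" where q: "\<And>x. x \<in> {0..1} \<Longrightarrow>
      \<bar>(\<Sum>k\<le>n. c k * Bernstein n k x) - (\<Sum>k\<le>n. of_int (q k) * Bernstein n k x)\<bar>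
        \<le> 2 / (1 + sqrt (real n * (x * (1 - x))))"
      using integer_Bernstein_rounding[of c] by blast
    define h where "h x = 2 powr p * ((1 + real n / 2 * x) powr - (p / 2) + (1 + real n / 2 * (1 - x)) powr - (p / 2))" for x
    have h: "(h has_integral 2 powr p * decay_integral (p / 2) n) {0..1}"
      unfolding h_def by (intro has_integral_mult_right has_integral_decay_integral n)
    \<comment> \<open>Continuity of \<open>powr\<close> with a negative exponent requires nonzero
      bases.\<close>
    have pos: "1 + real n / 2 * x \<noteq> 0" "1 + real n / 2 * (1 - x) \<noteq> 0" if "x \<in> {0..1}" for x
      using that by (auto intro!: add_pos_nonneg less_imp_neq[symmetric])
    have "Lp_norm p (\<lambda>x. (\<Sum>k\<le>n. c k * Bernstein n k x) - (\<Sum>k\<le>n. of_int (q k) * Bernstein n k x))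
        \<le> (2 powr p * decay_integral (p / 2) n) powr (1 / p)"
    proof (rule Lp_norm_le_powr[OF p _ h])
      show "continuous_on {0..1} h"
        unfolding h_def using pos by (intro continuous_intros) auto
      show "\<bar>(\<Sum>k\<le>n. c k * Bernstein n k x) - (\<Sum>k\<le>n. of_int (q k) * Bernstein n k x)\<bar> powr p \<le> h x"
        if "x \<in> {0..1}" for x
        using powr_mono2[OF _ _ q[OF that], of p] decay_powr_le[OF _ that, of p n] p
        unfolding h_def by linarith
    qed (intro Lp01_continuous p continuous_intros)
    also have "\<dots> \<le> (2 powr p * (K * theta p n powr p)) powr (1 / p)"
      \<comment> \<open>Monotonicity of the \<open>1 / p\<close> power needs a nonnegative base,
        which the integral of the nonnegative \<open>h\<close> supplies.\<close>
      using has_integral_nonneg[OF h] K(2)[of n] n p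
      by (intro powr_mono2) (auto simp: h_def)
    also have "\<dots> = 2 * K powr (1 / p) * theta p n"
      using p theta_nonneg[OF n(1), of p] by (simp add: powr_mult powr_powr)
    finally show ?thesis by blast
  qed
  then show ?thesis using K(1) by (intro exI[of _ "2 * K powr (1 / p)"]) auto
qed

subsection \<open>Density of continuous functions in \<open>L\<^sup>p\<close>\<close>

lemma Lp_norm_tendsto_0_dominated:
  assumes p: "1 \<le> p"
    and meas: "\<And>n. F n \<in> borel_measurable (lebesgue_on {0..1})"
    and w: "integrable (lebesgue_on {0..1}) w"
    and le: "\<And>n x. x \<in> {0..1} \<Longrightarrow> \<bar>F n x\<bar> powr p \<le> w x"
    and lim: "AE x in lebesgue_on {0..1}. (\<lambda>n. F n x) \<longlonglongrightarrow> 0"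
  shows "(\<lambda>n. Lp_norm p (F n)) \<longlonglongrightarrow> 0"
proof -
  have lim_p: "(\<lambda>n. \<bar>y n\<bar> powr p) \<longlonglongrightarrow> 0" if "y \<longlonglongrightarrow> 0" for y :: "nat \<Rightarrow> real"
    using p that by (intro tendsto_zero_powrI[where b = p] tendsto_rabs_zero) auto
  have "(\<lambda>n. \<integral>x. \<bar>F n x\<bar> powr p \<partial>lebesgue_on {0..1}) \<longlonglongrightarrow> (\<integral>x. 0 \<partial>lebesgue_on {0..1 :: real})"
  proof (rule integral_dominated_convergence[where w = w])
    show "AE x in lebesgue_on {0..1}. (\<lambda>n. \<bar>F n x\<bar> powr p) \<longlonglongrightarrow> 0"
      using lim by eventually_elim (rule lim_p)
    show "(\<lambda>x. \<bar>F n x\<bar> powr p) \<in> borel_measurable (lebesgue_on {0..1})" for n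
      using meas[of n] by measurable
    show "AE x in lebesgue_on {0..1}. norm (\<bar>F n x\<bar> powr p) \<le> w x" for n
      using le by (intro AE_I2) auto
  qed (use w in auto)
  then have "(\<lambda>n. \<integral>x. \<bar>F n x\<bar> powr p \<partial>lebesgue_on {0..1}) \<longlonglongrightarrow> 0" by simp
  then show ?thesis
    unfolding Lp_norm_def using p
    by (intro tendsto_zero_powrI[where b = "1 / p"]) (auto intro!: always_eventually integral_nonneg)
qed

text \<open>Truncation at height \<open>M\<close>. It supplies the constant majorant for dominated
  convergence and preserves continuity.\<close>

definition clip :: "real \<Rightarrow> real \<Rightarrow> real" where
  "clip M y = max (- M) (min M y)"

lemma abs_clip_le: "0 \<le> M \<Longrightarrow> \<bar>clip M y\<bar> \<le> M"
  by (auto simp: clip_def)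

lemma abs_diff_clip_le: "0 \<le> M \<Longrightarrow> \<bar>y - clip M y\<bar> \<le> \<bar>y\<bar>"
  by (auto simp: clip_def)

lemma clip_eq: "\<bar>y\<bar> \<le> M \<Longrightarrow> clip M y = y"
  by (auto simp: clip_def)

lemma continuous_on_clip [continuous_intros]:
  "continuous_on S f \<Longrightarrow> continuous_on S (\<lambda>x. clip M (f x))"
  unfolding clip_def by (intro continuous_intros)

lemma measurable_clip [measurable]: "clip M \<in> borel_measurable borel"
  unfolding clip_def[abs_def] by measurable

lemma Lp_norm_clip_tendsto:
  assumes p: "1 \<le> p" and f: "f \<in> Lp01 p"
  shows "(\<lambda>n. Lp_norm p (\<lambda>x. f x - clip (real n) (f x))) \<longlonglongrightarrow> 0"
proof (rule Lp_norm_tendsto_0_dominated[OF p, where w = "\<lambda>x. \<bar>f x\<bar> powr p"])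
  have [measurable]: "f \<in> borel_measurable (lebesgue_on {0..1})"
    using f by (simp add: Lp01_def)
  show "(\<lambda>x. f x - clip (real n) (f x)) \<in> borel_measurable (lebesgue_on {0..1})" for n
    by measurable
  show "integrable (lebesgue_on {0..1}) (\<lambda>x. \<bar>f x\<bar> powr p)"
    using f by (simp add: Lp01_def)
  show "\<bar>f x - clip (real n) (f x)\<bar> powr p \<le> \<bar>f x\<bar> powr p" for n x
    using p by (intro powr_mono2 abs_diff_clip_le) auto
  \<comment> \<open>At a fixed point truncation has no effect once \<open>n\<close> exceeds the
    absolute value of \<open>f x\<close>.\<close>
  have "eventually (\<lambda>n. f x - clip (real n) (f x) = 0) sequentially" for x
    using eventually_ge_at_top[of "nat \<lceil>\<bar>f x\<bar>\<rceil>"]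
    by eventually_elim (simp add: clip_eq nat_ceiling_le_eq)
  then show "AE x in lebesgue_on {0..1}. (\<lambda>n. f x - clip (real n) (f x)) \<longlonglongrightarrow> 0"
    by (intro AE_I2 tendsto_eventually)
qed

text \<open>Measurability of \<open>f\<close> yields continuous functions converging to it almost
  everywhere. Clipping them as well keeps all differences below \<open>2 * M\<close>, so dominated
  convergence applies.\<close>

lemma Lp_continuous_approx_clip:
  assumes p: "1 \<le> p" and f: "f \<in> borel_measurable (lebesgue_on {0..1})" and M: "0 \<le> M" and e: "0 < e"
  shows "\<exists>g. continuous_on UNIV g \<and> Lp_norm p (\<lambda>x. clip M (f x) - g x) < e"
proof -
  note [measurable] = f
  have "f measurable_on {0..1}"
    using f by (simp add: measurable_on_iff_borel_measurable)
  then obtain N g where N: "negligible N" and g: "\<And>n. continuous_on UNIV (g n)"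
    and lim: "\<And>x. x \<notin> N \<Longrightarrow> (\<lambda>n. g n x) \<longlonglongrightarrow> (if x \<in> {0..1} then f x else 0)"
    unfolding measurable_on_def by blast
  have gm [measurable]: "g n \<in> borel_measurable (lebesgue_on {0..1})" for n
    using continuous_on_subset[OF g] by (intro continuous_imp_measurable_on_sets_lebesgue) auto
  have "(\<lambda>n. Lp_norm p (\<lambda>x. clip M (f x) - clip M (g n x))) \<longlonglongrightarrow> 0"
  proof (rule Lp_norm_tendsto_0_dominated[OF p, where w = "\<lambda>x. (2 * M) powr p"])
    show "(\<lambda>x. clip M (f x) - clip M (g n x)) \<in> borel_measurable (lebesgue_on {0..1})" for n
      by measurable
    show "integrable (lebesgue_on {0..1}) (\<lambda>x :: real. (2 * M) powr p)"
      by (intro continuous_imp_integrable_real continuous_intros)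
    show "\<bar>clip M (f x) - clip M (g n x)\<bar> powr p \<le> (2 * M) powr p" for n x
      using p abs_clip_le[OF M, of "f x"] abs_clip_le[OF M, of "g n x"] by (intro powr_mono2) auto
    have "N \<inter> {0..1} \<in> null_sets (lebesgue_on {0..1})"
      using N by (subst null_sets_restrict_space) (auto simp: negligible_iff_null_sets intro: null_set_Int2)
    then show "AE x in lebesgue_on {0..1}. (\<lambda>n. clip M (f x) - clip M (g n x)) \<longlonglongrightarrow> 0"
    proof (rule AE_I')
      have "(\<lambda>n. clip M (f x) - clip M (g n x)) \<longlonglongrightarrow> 0" if "x \<notin> N" "x \<in> {0..1}" for x
      proof -
        have "(\<lambda>n. g n x) \<longlonglongrightarrow> f x" using lim[OF that(1)] that(2) by simp
        then have "(\<lambda>n. clip M (f x) - clip M (g n x)) \<longlonglongrightarrow> clip M (f x) - clip M (f x)"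
          unfolding clip_def by (intro tendsto_intros)
        then show ?thesis by simp
      qed
      then show "{x \<in> space (lebesgue_on {0..1}). \<not> (\<lambda>n. clip M (f x) - clip M (g n x)) \<longlonglongrightarrow> 0}
          \<subseteq> N \<inter> {0..1}"
        by auto
    qed
  qed
  then have "eventually (\<lambda>n. Lp_norm p (\<lambda>x. clip M (f x) - clip M (g n x)) < e) sequentially"
    using e by (rule order_tendstoD)
  then obtain n where "Lp_norm p (\<lambda>x. clip M (f x) - clip M (g n x)) < e"
    by (auto simp: eventually_sequentially)
  then show ?thesis by (intro exI[of _ "\<lambda>x. clip M (g n x)"]) (auto intro!: continuous_on_clip g)
qed

lemma Lp_continuous_approx:
  assumes p: "1 \<le> p" and f: "f \<in> Lp01 p" and e: "0 < e"
  shows "\<exists>g. continuous_on UNIV g \<and> Lp_norm p (\<lambda>x. f x - g x) < e"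
proof -
  have fm [measurable]: "f \<in> borel_measurable (lebesgue_on {0..1})"
    using f by (simp add: Lp01_def)
  \<comment> \<open>Two errors below \<open>e / 4\<close>, doubled by the crude triangle inequality,
    stay below \<open>e\<close>.\<close>
  have "eventually (\<lambda>n. Lp_norm p (\<lambda>x. f x - clip (real n) (f x)) < e / 4) sequentially"
    using Lp_norm_clip_tendsto[OF p f] by (rule order_tendstoD) (use e in simp)
  then obtain M where M: "Lp_norm p (\<lambda>x. f x - clip (real M) (f x)) < e / 4"
    by (auto simp: eventually_sequentially)
  obtain g where g: "continuous_on UNIV g" and gM: "Lp_norm p (\<lambda>x. clip (real M) (f x) - g x) < e / 4"
    using Lp_continuous_approx_clip[OF p fm, of "real M" "e / 4"] e by auto
  have cl: "(\<lambda>x. clip (real M) (f x)) \<in> Lp01 p"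
  proof -
    have "integrable (lebesgue_on {0..1}) (\<lambda>x :: real. real M powr p)"
      by (intro continuous_imp_integrable_real continuous_intros)
    then have "integrable (lebesgue_on {0..1}) (\<lambda>x. \<bar>clip (real M) (f x)\<bar> powr p)"
      by (rule Bochner_Integration.integrable_bound)
         (use p abs_clip_le[of "real M"] in \<open>auto intro!: AE_I2 powr_mono2\<close>)
    then show ?thesis by (simp add: Lp01_def)
  qed
  have "g \<in> Lp01 p" using g p by (intro Lp01_continuous continuous_on_subset[OF g]) auto
  then have "Lp_norm p (\<lambda>x. (f x - clip (real M) (f x)) + (clip (real M) (f x) - g x))
      \<le> 2 * (Lp_norm p (\<lambda>x. f x - clip (real M) (f x)) + Lp_norm p (\<lambda>x. clip (real M) (f x) - g x))"
    by (intro Lp_norm_add_le Lp01_diff p f cl)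
  with M gM g show ?thesis by (intro exI[of _ g]) auto
qed

subsection \<open>Approximation by Bernstein lattices\<close>

lemma Bernstein_lattice_subset_Lp01: "1 \<le> p \<Longrightarrow> Bernstein_lattice n \<subseteq> Lp01 p"
  unfolding Bernstein_lattice_def by (auto intro!: Lp01_continuous continuous_on_Bernstein_sum)

lemma integer_Bernstein_approx_Lp:
  assumes p: "1 \<le> p"
  shows "\<exists>K>0. \<forall>f\<in>Lp01 p. \<forall>n. 0 < n \<and> \<not> (p = 2 \<and> n = 1) \<longrightarrow> (\<exists>q :: nat \<Rightarrow> int.
    Lp_norm p (\<lambda>x. f x - (\<Sum>k\<le>n. of_int (q k) * Bernstein n k x))
      \<le> 2 * (best_approx_Lp n p f + K * theta p n))"
proof -
  obtain K where K: "K > 0" and round: "\<And>n c. 0 < n \<and> \<not> (p = 2 \<and> n = 1) \<Longrightarrow> (\<exists>q :: nat \<Rightarrow> int.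
    Lp_norm p (\<lambda>x. (\<Sum>k\<le>n. c k * Bernstein n k x) - (\<Sum>k\<le>n. of_int (q k) * Bernstein n k x))
      \<le> K * theta p n)"
    using integer_Bernstein_rounding_Lp[OF p] by blast
  have "\<exists>q :: nat \<Rightarrow> int. Lp_norm p (\<lambda>x. f x - (\<Sum>k\<le>n. of_int (q k) * Bernstein n k x))
      \<le> 2 * (best_approx_Lp n p f + (1 + K) * theta p n)"
    if f: "f \<in> Lp01 p" and n: "0 < n \<and> \<not> (p = 2 \<and> n = 1)" for f n
  proof -
    \<comment> \<open>A slack of size \<open>theta p n\<close> yields a near-best polynomial and is
      absorbed by replacing \<open>K\<close> with \<open>1 + K\<close>. Excluding
      \<open>p = 2\<close>, \<open>n = 1\<close> makes it positive.\<close>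
    have "best_approx_Lp n p f < best_approx_Lp n p f + theta p n"
      using n theta_pos[of n p] by simp
    then obtain P :: "real poly" where P: "degree P \<le> n"
      and le: "Lp_norm p (\<lambda>x. f x - poly P x) < best_approx_Lp n p f + theta p n"
      unfolding best_approx_Lp_def[of n p f]
      by (subst (asm) cINF_less_iff) (auto intro!: bdd_belowI2[where m = 0] Lp_norm_nonneg exI[of _ 0])
    obtain c where c: "\<And>x. poly P x = (\<Sum>k\<le>n. c k * Bernstein n k x)"
      using poly_eq_Bernstein_sum[OF P] by blast
    obtain q :: "nat \<Rightarrow> int" where q: "Lp_norm p (\<lambda>x. poly P x - (\<Sum>k\<le>n. of_int (q k) * Bernstein n k x)) \<le> K * theta p n"
      using round[OF n, of c] unfolding c by blast
    have "Lp_norm p (\<lambda>x. (f x - poly P x) + (poly P x - (\<Sum>k\<le>n. of_int (q k) * Bernstein n k x)))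
      \<le> 2 * (Lp_norm p (\<lambda>x. f x - poly P x)
             + Lp_norm p (\<lambda>x. poly P x - (\<Sum>k\<le>n. of_int (q k) * Bernstein n k x)))"
      unfolding c by (intro Lp_norm_add_le Lp01_diff Lp01_continuous p f continuous_intros)
    also have "\<dots> \<le> 2 * (best_approx_Lp n p f + (1 + K) * theta p n)"
      using le q by (simp add: distrib_right)
    finally show ?thesis by auto
  qed
  then show ?thesis using K by (intro exI[of _ "1 + K"]) auto
qed

section \<open>Pointwise approximation of continuous functions\<close>

lemma bdd_above_abs_diff_poly:
  fixes P :: "real poly"
  assumes "continuous_on {0..1} f"
  shows "bdd_above ((\<lambda>x. \<bar>f x - poly P x\<bar>) ` {0..1})"
  by (intro bounded_imp_bdd_above compact_imp_bounded compact_continuous_image continuous_intros assms) auto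

lemma SUP_abs_diff_poly_nonneg:
  fixes P :: "real poly"
  assumes "continuous_on {0..1} f"
  shows "0 \<le> (SUP x\<in>{0..1}. \<bar>f x - poly P x\<bar>)"
  by (rule order.trans[OF abs_ge_zero cSUP_upper[OF _ bdd_above_abs_diff_poly[OF assms], of 0]]) auto

lemma best_approx_sup_nonneg:
  assumes "continuous_on {0..1} f"
  shows "0 \<le> best_approx_sup n f"
  unfolding best_approx_sup_def
  by (intro cINF_greatest SUP_abs_diff_poly_nonneg assms) (auto intro!: exI[of _ 0])

lemma integer_Bernstein_approx_sup:
  assumes f: "continuous_on {0..1} f" and n: "0 < n"
  shows "\<exists>q :: nat \<Rightarrow> int. \<forall>x\<in>{0..1}. \<bar>f x - (\<Sum>k\<le>n. of_int (q k) * Bernstein n k x)\<bar>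
      \<le> best_approx_sup n f + 3 / (1 + sqrt (real n * (x * (1 - x))))"
proof -
  define E where "E = best_approx_sup n f"
  \<comment> \<open>The infimum need not be shown to be attained: a slack \<open>d\<close> below the error term suffices.\<close>
  define d where "d = 1 / (1 + sqrt (real n))"
  note bdd = bdd_above_abs_diff_poly[OF f]
  have bddE: "bdd_below ((\<lambda>P :: real poly. SUP x\<in>{0..1}. \<bar>f x - poly P x\<bar>) ` {P. degree P \<le> n})"
    by (intro bdd_belowI2[where m = 0] SUP_abs_diff_poly_nonneg f)
  have "E < E + d" by (simp add: d_def add_pos_nonneg)
  then obtain P :: "real poly" where P: "degree P \<le> n" and le: "(SUP x\<in>{0..1}. \<bar>f x - poly P x\<bar>) < E + d"
    using bddE unfolding E_def best_approx_sup_def by (subst (asm) cINF_less_iff) (auto intro!: exI[of _ 0])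
  obtain c where c: "\<And>x. poly P x = (\<Sum>k\<le>n. c k * Bernstein n k x)"
    using poly_eq_Bernstein_sum[OF P] by blast
  obtain q :: "nat \<Rightarrow> int" where q: "\<And>x. x \<in> {0..1} \<Longrightarrow>
      \<bar>poly P x - (\<Sum>k\<le>n. of_int (q k) * Bernstein n k x)\<bar> \<le> 2 / (1 + sqrt (real n * (x * (1 - x))))"
    using integer_Bernstein_rounding[of c] unfolding c by blast
  have "\<bar>f x - (\<Sum>k\<le>n. of_int (q k) * Bernstein n k x)\<bar> \<le> E + 3 / (1 + sqrt (real n * (x * (1 - x))))"
    if x: "x \<in> {0..1}" for x
  proof -
    have X: "0 \<le> x * (1 - x)" "x * (1 - x) \<le> 1"
      using x by (auto intro: mult_le_one)
    have "\<bar>f x - poly P x\<bar> \<le> E + d"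
      using cSUP_upper[OF x bdd, of P] le by linarith
    \<comment> \<open>Since \<open>X \<le> 1\<close>, the slack lies below the error term at every
      \<open>x\<close>; with the rounding constant 2 this makes 3.\<close>
    moreover have "d \<le> 1 / (1 + sqrt (real n * (x * (1 - x))))"
      unfolding d_def using X mult_left_mono[OF X(2), of "real n"]
      by (intro divide_left_mono mult_pos_pos add_pos_nonneg) auto
    ultimately show ?thesis using q[OF x] by linarith
  qed
  then show ?thesis unfolding E_def by blast
qed

section \<open>Density of unions of Bernstein lattices\<close>

text \<open>A chain of three approximations: \<open>f\<close> by a continuous \<open>g\<close>,
  \<open>g\<close> by its Bernstein polynomial, and that by rounding the coefficients
  \<open>g (k / n)\<close>, which Bernstein's theorem provides explicitly.\<close>

lemma Bernstein_lattices_dense_Lp: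
  assumes p: "1 \<le> p" and N: "filterlim N at_top sequentially" "\<And>j. 1 \<le> j \<Longrightarrow> 0 < N j"
  shows "dense_in_Lp01 p (\<Union>j\<in>{1..}. Bernstein_lattice (N j))"
  unfolding dense_in_Lp01_def
proof (intro conjI ballI allI impI)
  show "(\<Union>j\<in>{1..}. Bernstein_lattice (N j)) \<subseteq> Lp01 p"
    using Bernstein_lattice_subset_Lp01[OF p] by blast
next
  fix f e assume f: "f \<in> Lp01 p" and e: "(e :: real) > 0"
  obtain K where K: "K > 0" and round: "\<And>n c. 0 < n \<and> \<not> (p = 2 \<and> n = 1) \<Longrightarrow> (\<exists>q :: nat \<Rightarrow> int.
    Lp_norm p (\<lambda>x. (\<Sum>k\<le>n. c k * Bernstein n k x) - (\<Sum>k\<le>n. of_int (q k) * Bernstein n k x))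
      \<le> K * theta p n)"
    using integer_Bernstein_rounding_Lp[OF p] by blast
  \<comment> \<open>The triangle inequality is applied twice, each time with a factor 2: errors of
    \<open>e / 16\<close> give \<open>e / 4\<close> for \<open>g - L\<close> and then
    \<open>5 * e / 8\<close> for \<open>f - L\<close>.\<close>
  obtain g where g: "continuous_on UNIV g" and fg: "Lp_norm p (\<lambda>x. f x - g x) < e / 16"
    using Lp_continuous_approx[OF p f, of "e / 16"] e by auto
  have g01: "continuous_on {0..1} g" by (rule continuous_on_subset[OF g]) simp
  obtain m where m: "\<And>n x. m \<le> n \<Longrightarrow> x \<in> {0..1} \<Longrightarrow>
      \<bar>g x - (\<Sum>k\<le>n. g (real k / real n) * Bernstein n k x)\<bar> < e / 16"
    using Bernstein_Weierstrass[OF g01, of "e / 16"] e by auto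
  have "(\<lambda>n. K * theta p n) \<longlonglongrightarrow> K * 0" by (intro tendsto_intros theta_tendsto_0 p)
  then have "eventually (\<lambda>n. K * theta p n < e / 16) sequentially"
    by (rule order_tendstoD) (use e in simp)
  \<comment> \<open>The condition \<open>2 \<le> n\<close> keeps clear of the excluded case
    \<open>p = 2\<close>, \<open>n = 1\<close>.\<close>
  then have "eventually (\<lambda>n. K * theta p n < e / 16 \<and> m \<le> n \<and> 2 \<le> n) sequentially"
    by (intro eventually_conj eventually_ge_at_top)
  then have "eventually (\<lambda>j. K * theta p (N j) < e / 16 \<and> m \<le> N j \<and> 2 \<le> N j) sequentially"
    using N(1) by (rule eventually_compose_filterlim)
  then have "eventually (\<lambda>j. (K * theta p (N j) < e / 16 \<and> m \<le> N j \<and> 2 \<le> N j) \<and> 1 \<le> j) sequentially"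
    by (rule eventually_conj[OF _ eventually_ge_at_top])
  then obtain j where j: "K * theta p (N j) < e / 16" "m \<le> N j" "2 \<le> N j" "1 \<le> j"
    unfolding eventually_sequentially by blast
  define n where "n = N j"
  define B where "B x = (\<Sum>k\<le>n. g (real k / real n) * Bernstein n k x)" for x
  obtain q :: "nat \<Rightarrow> int" where "Lp_norm p (\<lambda>x. B x - (\<Sum>k\<le>n. of_int (q k) * Bernstein n k x)) \<le> K * theta p n"
    using round[of n "\<lambda>k. g (real k / real n)"] j unfolding B_def n_def by auto
  moreover define L where "L x = (\<Sum>k\<le>n. of_int (q k) * Bernstein n k x)" for x
  ultimately have BL: "Lp_norm p (\<lambda>x. B x - L x) < e / 16"
    using j by (simp add: n_def)
  have mem: "g \<in> Lp01 p" "B \<in> Lp01 p" "L \<in> Lp01 p"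
    unfolding B_def[abs_def] L_def[abs_def]
    by (intro Lp01_continuous p g01 continuous_intros)+
  have gB: "Lp_norm p (\<lambda>x. g x - B x) \<le> e / 16"
    using mem m[of n] j unfolding B_def n_def
    by (intro Lp_norm_le_const Lp01_diff p) (auto intro: less_imp_le)
  have "Lp_norm p (\<lambda>x. (g x - B x) + (B x - L x)) \<le> 2 * (Lp_norm p (\<lambda>x. g x - B x) + Lp_norm p (\<lambda>x. B x - L x))"
    by (intro Lp_norm_add_le Lp01_diff p mem)
  then have gL: "Lp_norm p (\<lambda>x. g x - L x) \<le> e / 4"
    using gB BL by simp
  have "Lp_norm p (\<lambda>x. (f x - g x) + (g x - L x)) \<le> 2 * (Lp_norm p (\<lambda>x. f x - g x) + Lp_norm p (\<lambda>x. g x - L x))"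
    by (intro Lp_norm_add_le Lp01_diff p f mem)
  then have "Lp_norm p (\<lambda>x. f x - L x) < e"
    using fg gL e by simp
  moreover have "L \<in> Bernstein_lattice (N j)"
    unfolding Bernstein_lattice_def L_def[abs_def] n_def by blast
  ultimately show "\<exists>g\<in>\<Union>j\<in>{1..}. Bernstein_lattice (N j). Lp_norm p (\<lambda>x. f x - g x) < e"
    using j(4) by (intro bexI[of _ L]) auto
qed

text \<open>\<open>cfunspace\<close> consists of bounded continuous functions; compactness of the
  interval makes boundedness automatic.\<close>

lemma mspace_C_interval:
  "mspace (C_interval a b) = {f. f \<in> extensional {a..b} \<and> continuous_on {a..b} f}"
proof -
  have "compactin (top_of_set {a..b}) (topspace (top_of_set {a..b}))"
    by (simp add: compactin_subtopology)
  then show ?thesis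
    unfolding C_interval_def by (subst compactin_mspace_cfunspace) auto
qed

text \<open>Away from the endpoints \<open>X\<close> is bounded below by \<open>a * (1 - b)\<close>,
  so there the pointwise rounding error tends to 0 uniformly.\<close>

lemma Bernstein_lattices_dense_C_interval:
  assumes N: "filterlim N at_top sequentially" and ab: "0 < a" "a < b" "b < 1"
  shows "mtopology_of (C_interval a b) closure_of
           ((\<lambda>g. restrict g {a..b}) ` (\<Union>j\<in>{1..}. Bernstein_lattice (N j)))
         = mspace (C_interval a b)"
proof -
  have "\<exists>j\<ge>1. \<exists>g\<in>Bernstein_lattice (N j). mdist (C_interval a b) f (restrict g {a..b}) < e"
    if f: "f \<in> mspace (C_interval a b)" and e: "0 < e" for f e
  proof -
    \<comment> \<open>Clamping the argument extends \<open>f\<close> continuously to the unit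
      interval, so that Bernstein's theorem applies.\<close>
    define h where "h x = f (max a (min b x))" for x
    have cf: "continuous_on {a..b} f" using f by (simp add: mspace_C_interval)
    have h: "continuous_on {0..1} h"
      unfolding h_def using ab by (intro continuous_on_compose2[OF cf] continuous_intros) auto
    obtain m where m: "\<And>n x. m \<le> n \<Longrightarrow> x \<in> {0..1} \<Longrightarrow>
        \<bar>h x - (\<Sum>k\<le>n. h (real k / real n) * Bernstein n k x)\<bar> < e / 4"
      using Bernstein_Weierstrass[OF h, of "e / 4"] e by auto
    define D where "D = a * (1 - b)"
    have D: "D > 0" using ab by (simp add: D_def)
    have "(\<lambda>n. 2 / (1 + sqrt (real n * D))) \<longlonglongrightarrow> 0" using D by real_asymp
    then have "eventually (\<lambda>n. 2 / (1 + sqrt (real n * D)) < e / 4) sequentially"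
      by (rule order_tendstoD) (use e in simp)
    then have "eventually (\<lambda>n. 2 / (1 + sqrt (real n * D)) < e / 4 \<and> m \<le> n) sequentially"
      by (intro eventually_conj eventually_ge_at_top)
    then have "eventually (\<lambda>j. 2 / (1 + sqrt (real (N j) * D)) < e / 4 \<and> m \<le> N j) sequentially"
      using N by (rule eventually_compose_filterlim)
    then have "eventually (\<lambda>j. (2 / (1 + sqrt (real (N j) * D)) < e / 4 \<and> m \<le> N j) \<and> 1 \<le> j) sequentially"
      by (rule eventually_conj[OF _ eventually_ge_at_top])
    then obtain j where j: "2 / (1 + sqrt (real (N j) * D)) < e / 4" "m \<le> N j" "1 \<le> j"
      unfolding eventually_sequentially by blast
    define n where "n = N j"
    obtain q :: "nat \<Rightarrow> int" where q: "\<And>x. x \<in> {0..1} \<Longrightarrow>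
        \<bar>(\<Sum>k\<le>n. h (real k / real n) * Bernstein n k x) - (\<Sum>k\<le>n. of_int (q k) * Bernstein n k x)\<bar>
          \<le> 2 / (1 + sqrt (real n * (x * (1 - x))))"
      using integer_Bernstein_rounding[of "\<lambda>k. h (real k / real n)"] by blast
    define L where "L x = (\<Sum>k\<le>n. of_int (q k) * Bernstein n k x)" for x
    have "\<bar>f x - L x\<bar> \<le> e / 2" if x: "x \<in> {a..b}" for x
    proof -
      have x01: "x \<in> {0..1}" using x ab by auto
      have "D \<le> x * (1 - x)" unfolding D_def using x ab by (intro mult_mono) auto
      then have "real n * D \<le> real n * (x * (1 - x))" by (intro mult_left_mono) auto
      then have "2 / (1 + sqrt (real n * (x * (1 - x)))) \<le> 2 / (1 + sqrt (real n * D))"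
        using D x01 by (intro divide_left_mono mult_pos_pos add_pos_nonneg) auto
      moreover have "h x = f x" using x by (simp add: h_def)
      ultimately show ?thesis
        using q[OF x01] m[OF j(2) x01] j(1) unfolding L_def n_def by linarith
    qed
    \<comment> \<open>Passing to the supremum gives only a weak inequality; the margin down to
      \<open>e / 2\<close> recovers the strict one.\<close>
    then have "mdist (C_interval a b) f (restrict L {a..b}) \<le> e / 2"
      unfolding C_interval_def using e by (intro mdist_cfunspace_le) (auto simp: dist_real_def)
    moreover have "L \<in> Bernstein_lattice (N j)"
      unfolding Bernstein_lattice_def L_def[abs_def] n_def by blast
    ultimately show ?thesis using j(3) e by (intro exI[of _ j] conjI bexI[of _ L]) auto
  qed
  \<comment> \<open>Metric balls contain only points of the space, so the restrictions must be shown
    to belong to it.\<close>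
  moreover have "restrict g {a..b} \<in> mspace (C_interval a b)" if "g \<in> Bernstein_lattice n" for g n
  proof -
    have "continuous_on {a..b} g"
      using that unfolding Bernstein_lattice_def by (auto intro!: continuous_on_Bernstein_sum)
    then have "continuous_on {a..b} (restrict g {a..b})"
      by (subst continuous_on_cong[OF refl, where g = g]) auto
    then show ?thesis by (simp add: mspace_C_interval)
  qed
  ultimately show ?thesis
    unfolding mtopology_of_def
    by (subst Metric_space.metric_closure_of[OF Metric_space_mspace_mdist])
       (force simp: Metric_space.in_mball[OF Metric_space_mspace_mdist])
qed

text \<open>The case \<open>p = 2\<close>, \<open>n = 1\<close> is left out of the first claim
  because \<open>theta 2 1 = 0\<close>: for the constant function 1/2 the right-hand side would
  vanish, yet no integer combination of \<open>1 - x\<close> and \<open>x\<close> equals 1/2 almost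
  everywhere.\<close>

theorem theorem2:
  shows "(\<exists>C :: real. C > 0 \<and> (\<exists>Cp :: real \<Rightarrow> real. (\<forall>p\<ge>1. Cp p > 0) \<and>
      (\<forall>p\<ge>1. \<forall>f\<in>Lp01 p. \<forall>n :: nat. n > 0 \<and> \<not> (p = 2 \<and> n = 1) \<longrightarrow>
         (\<exists>q :: nat \<Rightarrow> int.
            Lp_norm p (\<lambda>x. f x - (\<Sum>k\<le>n. of_int (q k) * Bernstein n k x))
              \<le> C * (best_approx_Lp n p f + Cp p * theta p n))) \<and>
      (\<forall>f :: real \<Rightarrow> real. continuous_on {0..1} f \<longrightarrow> (\<forall>n :: nat. n > 0 \<longrightarrow>
         (\<exists>q :: nat \<Rightarrow> int. \<forall>x\<in>{0..1}.
            \<bar>f x - (\<Sum>k\<le>n. of_int (q k) * Bernstein n k x)\<bar>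
              \<le> C * (best_approx_sup n f + 1 / (1 + sqrt (real n * (x * (1 - x))))))))))
    \<and> (\<forall>N :: nat \<Rightarrow> nat. (\<forall>j\<ge>1. N j > 0) \<and> filterlim N at_top sequentially \<longrightarrow>
         (\<forall>p\<ge>1. dense_in_Lp01 p (\<Union>j\<in>{1..}. Bernstein_lattice (N j))) \<and>
         (\<forall>a b. 0 < a \<and> a < b \<and> b < 1 \<longrightarrow>
            mtopology_of (C_interval a b) closure_of
              ((\<lambda>g. restrict g {a..b}) ` (\<Union>j\<in>{1..}. Bernstein_lattice (N j)))
            = mspace (C_interval a b)))"
proof (intro conjI allI impI)
  \<comment> \<open>The constant found for each single \<open>p\<close> is turned into a function of
    \<open>p\<close> by choice.\<close>
  have "\<exists>K. \<forall>p\<ge>1. K p > 0 \<and> (\<forall>f\<in>Lp01 p. \<forall>n :: nat. n > 0 \<and> \<not> (p = 2 \<and> n = 1) \<longrightarrow>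
      (\<exists>q :: nat \<Rightarrow> int. Lp_norm p (\<lambda>x. f x - (\<Sum>k\<le>n. of_int (q k) * Bernstein n k x))
        \<le> 2 * (best_approx_Lp n p f + K p * theta p n)))"
    by (rule choice, intro allI) (use integer_Bernstein_approx_Lp in blast)
  then obtain K where K: "\<And>p. 1 \<le> p \<Longrightarrow> K p > 0"
    "\<And>p f n. 1 \<le> p \<Longrightarrow> f \<in> Lp01 p \<Longrightarrow> n > 0 \<and> \<not> (p = 2 \<and> n = 1) \<Longrightarrow>
      \<exists>q :: nat \<Rightarrow> int. Lp_norm p (\<lambda>x. f x - (\<Sum>k\<le>n. of_int (q k) * Bernstein n k x))
        \<le> 2 * (best_approx_Lp n p f + K p * theta p n)"
    by blast
  show "\<exists>C :: real. C > 0 \<and> (\<exists>Cp :: real \<Rightarrow> real. (\<forall>p\<ge>1. Cp p > 0) \<and>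
      (\<forall>p\<ge>1. \<forall>f\<in>Lp01 p. \<forall>n :: nat. n > 0 \<and> \<not> (p = 2 \<and> n = 1) \<longrightarrow>
         (\<exists>q :: nat \<Rightarrow> int.
            Lp_norm p (\<lambda>x. f x - (\<Sum>k\<le>n. of_int (q k) * Bernstein n k x))
              \<le> C * (best_approx_Lp n p f + Cp p * theta p n))) \<and>
      (\<forall>f :: real \<Rightarrow> real. continuous_on {0..1} f \<longrightarrow> (\<forall>n :: nat. n > 0 \<longrightarrow>
         (\<exists>q :: nat \<Rightarrow> int. \<forall>x\<in>{0..1}.
            \<bar>f x - (\<Sum>k\<le>n. of_int (q k) * Bernstein n k x)\<bar>
              \<le> C * (best_approx_sup n f + 1 / (1 + sqrt (real n * (x * (1 - x)))))))))"
  \<comment> \<open>The \<open>Lp_norm\<close> estimate holds with factor 2 and the pointwise one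
    with 3. Nonnegativity of the approximation errors and of \<open>theta\<close> lets 3 serve
    both.\<close>
  proof (intro exI[of _ 3] exI[of _ K] conjI allI impI ballI)
    fix p f and n :: nat
    assume p: "1 \<le> p" and f: "f \<in> Lp01 p" and n: "n > 0 \<and> \<not> (p = 2 \<and> n = 1)"
    have "0 \<le> best_approx_Lp n p f"
      unfolding best_approx_Lp_def by (intro cINF_greatest Lp_norm_nonneg) (auto intro!: exI[of _ 0])
    moreover have "0 \<le> K p * theta p n"
      using K(1)[OF p] theta_nonneg[of n p] n by simp
    ultimately have "2 * (best_approx_Lp n p f + K p * theta p n) \<le> 3 * (best_approx_Lp n p f + K p * theta p n)"
      by simp
    then show "\<exists>q :: nat \<Rightarrow> int. Lp_norm p (\<lambda>x. f x - (\<Sum>k\<le>n. of_int (q k) * Bernstein n k x))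
        \<le> 3 * (best_approx_Lp n p f + K p * theta p n)"
      using K(2)[OF p f n] order.trans by blast
  next
    fix f :: "real \<Rightarrow> real" and n :: nat
    assume f: "continuous_on {0..1} f" and n: "n > 0"
    obtain q :: "nat \<Rightarrow> int" where q: "\<And>x. x \<in> {0..1} \<Longrightarrow> \<bar>f x - (\<Sum>k\<le>n. of_int (q k) * Bernstein n k x)\<bar>
      \<le> best_approx_sup n f + 3 / (1 + sqrt (real n * (x * (1 - x))))"
      using integer_Bernstein_approx_sup[OF f n] by blast
    have "0 \<le> best_approx_sup n f"
      by (rule best_approx_sup_nonneg[OF f])
    then have "\<bar>f x - (\<Sum>k\<le>n. of_int (q k) * Bernstein n k x)\<bar>
      \<le> 3 * (best_approx_sup n f + 1 / (1 + sqrt (real n * (x * (1 - x)))))" if "x \<in> {0..1}" for x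
      using q[OF that] by simp
    then show "\<exists>q :: nat \<Rightarrow> int. \<forall>x\<in>{0..1}.
        \<bar>f x - (\<Sum>k\<le>n. of_int (q k) * Bernstein n k x)\<bar>
          \<le> 3 * (best_approx_sup n f + 1 / (1 + sqrt (real n * (x * (1 - x)))))"
      by blast
  qed (use K(1) in auto)
next
  fix N :: "nat \<Rightarrow> nat" and p :: real
  assume "(\<forall>j\<ge>1. N j > 0) \<and> filterlim N at_top sequentially" "1 \<le> p"
  then show "dense_in_Lp01 p (\<Union>j\<in>{1..}. Bernstein_lattice (N j))"
    by (intro Bernstein_lattices_dense_Lp) auto
next
  fix N :: "nat \<Rightarrow> nat" and a b :: real
  assume "(\<forall>j\<ge>1. N j > 0) \<and> filterlim N at_top sequentially" "0 < a \<and> a < b \<and> b < 1"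
  then show "mtopology_of (C_interval a b) closure_of
      ((\<lambda>g. restrict g {a..b}) ` (\<Union>j\<in>{1..}. Bernstein_lattice (N j))) = mspace (C_interval a b)"
    by (intro Bernstein_lattices_dense_C_interval) auto
qed

end
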